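(* Let $\xi\in(0,1]$, let $\epsilon_1,\epsilon_2,\dots$ be independent Rademacher random variables, let $S_n=\epsilon_1+\dots+\epsilon_n$ (with $S_0=0$), and for integers $n\ge 0$ let $P_n=\mathbb{P}\{|S_n|\le \xi\sqrt n\}$. Then for all integers $n\ge 2$, $$P_n\ge\begin{cases}1/2, & \text{if } \xi=1,\\ 3/8, & \text{if } \xi\in[\sqrt{2/3},1),\\ 5/16, & \text{if } \xi\in[\sqrt{1/2},\sqrt{2/3}).\end{cases}$$ More generally, for $k\in\{1,2\}$ let $n_k=2\left\lceil\frac{\frac{k^2}{\xi^2}+k}{2}\right\rceil-k-1$. If $0<\xi\le 1$ and $n_2\ge 3$, $n_2$ odd, then $$\frac{2}{\sqrt{n_2+1}}\le \xi<\frac{2}{\sqrt{n_2-1}},\qquad n_1=2\left\lceil\frac{n_2-3}{8}\right\rceil,$$ and for all integers $n\ge n_1$, $$P_n\ge P_{n_2-1}=\binom{n_2-1}{(n_2-1)/2}2^{-(n_2-1)}.$$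
   Context: A Rademacher random variable $\epsilon$ satisfies $\mathbb{P}\{\epsilon=1\}=\mathbb{P}\{\epsilon=-1\}=1/2$. *)

theory Defs
  imports "HOL-Probability.Probability"
begin

definition rademacher :: "'a measure \<Rightarrow> ('a \<Rightarrow> real) \<Rightarrow> bool" where
  "rademacher M X \<longleftrightarrow>
     X \<in> borel_measurable M \<and>
     \<P>(\<omega> in M. X \<omega> = 1) = 1 / 2 \<and>
     \<P>(\<omega> in M. X \<omega> = - 1) = 1 / 2"

(* The sequence is indexed from 1; the value at index 0 is never used. *)
definition independent_rademacher :: "'a measure \<Rightarrow> (nat \<Rightarrow> 'a \<Rightarrow> real) \<Rightarrow> bool" where
  "independent_rademacher M \<epsilon> \<longleftrightarrow>
     prob_space.indep_vars M (\<lambda>_. borel) \<epsilon> {1..} \<and> (\<forall>i\<ge>1. rademacher M (\<epsilon> i))"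

definition partial_sum :: "(nat \<Rightarrow> 'a \<Rightarrow> real) \<Rightarrow> nat \<Rightarrow> 'a \<Rightarrow> real" where
  "partial_sum \<epsilon> n \<omega> = (\<Sum>i=1..n. \<epsilon> i \<omega>)"

definition P :: "'a measure \<Rightarrow> (nat \<Rightarrow> 'a \<Rightarrow> real) \<Rightarrow> real \<Rightarrow> nat \<Rightarrow> real" where
  "P M \<epsilon> \<xi> n = \<P>(\<omega> in M. \<bar>partial_sum \<epsilon> n \<omega>\<bar> \<le> \<xi> * sqrt (real n))"

definition n_idx :: "real \<Rightarrow> nat \<Rightarrow> int" where
  "n_idx \<xi> k = 2 * \<lceil>((real k)\<^sup>2 / \<xi>\<^sup>2 + real k) / 2\<rceil> - int k - 1"

end

theory Submission imports Defs begin

text \<open>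
  Among the values of \<open>n\<close> of fixed parity, \<open>P\<^sub>n\<close> decreases except when \<open>\<xi> sqrt n\<close> passes an
  integer \<open>k \<equiv> n\<close> (mod 2); so only the last \<open>n\<close> before such a jump matters, and there
  \<open>n \<approx> k\<^sup>2 (m + 1) / 2\<close> where \<open>m < 2 / \<xi>\<^sup>2 \<le> m + 1\<close>. For \<open>k = 2\<close> this is \<open>n = 2 m\<close>, the claimed minimum.
  For \<open>k > 2\<close> the \<open>k - 1\<close> binomial coefficients counted by \<open>P\<^sub>n\<close> are bounded below by the central one
  times \<open>1 - i (i + d) / (c + 1)\<close>, with \<open>n = 2 c - d\<close> and offset \<open>i\<close>; since
  \<open>binom(2a, a) 4\<^sup>-\<^sup>a sqrt (4 a + 1)\<close> increases in \<open>a\<close>, the comparison with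
  \<open>binom(2m, m) 4\<^sup>-\<^sup>m\<close> becomes a polynomial inequality.
\<close>

text \<open>Counts the sign patterns with \<open>\<bar>S\<^sub>n\<bar> \<le> n - 2 l\<close>.\<close>
definition window :: "nat \<Rightarrow> nat \<Rightarrow> nat" where
  "window n l = (\<Sum>j=l..n-l. n choose j)"

section \<open>Central binomial probabilities\<close>

text \<open>The probability that \<open>2 * a\<close> independent fair signs sum to zero; the lower
  bounds of the theorem are its values at \<open>m\<close>, where
  \<open>n_idx \<xi> 2 = 2 * m + 1\<close>.\<close>

definition central :: "nat \<Rightarrow> real" where
  "central a = real ((2 * a) choose a) / 4 ^ a"

lemma central_pos: "central a > 0"
  by (simp add: central_def)

lemma central_Suc: "central (Suc a) = central a * (2 * real a + 1) / (2 * real a + 2)"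
proof -
  have 1: "Suc (2*a+1) * ((2*a+1) choose a) = (Suc (2*a+1) choose Suc a) * Suc a"
    by (rule Suc_times_binomial_eq)
  have 2: "Suc (2*a) * ((2*a) choose a) = (Suc (2*a) choose Suc a) * Suc a"
    by (rule Suc_times_binomial_eq)
  have 3: "(Suc (2*a) choose Suc a) = ((2*a+1) choose a)"
    using binomial_symmetric[of a "2*a+1"] by simp
  have "(real a + 1) * (2 * real ((2*a+1) choose a)) = (real a + 1) * real ((2 * Suc a) choose Suc a)"
    using arg_cong[OF 1, of real] by (simp add: algebra_simps del: binomial_Suc_Suc)
  hence r1: "real ((2 * Suc a) choose Suc a) = 2 * real ((2*a+1) choose a)"
    by (subst (asm) mult_cancel_left) auto
  have r2: "(2 * real a + 1) * real ((2*a) choose a) = (real a + 1) * real ((2*a+1) choose a)"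
    using arg_cong[OF 2, of real] unfolding 3 by (simp add: algebra_simps)
  have r3: "real ((2*a+1) choose a) = (2 * real a + 1) * real ((2*a) choose a) / (real a + 1)"
    using r2 by (simp add: field_simps)
  show ?thesis
    unfolding central_def r1 r3 by (simp add: divide_simps)
qed

text \<open>After \<open>central_Suc\<close> the claim for consecutive indices is
  \<open>(4a + 1)(2a + 2)^2 \<le> (2a + 1)^2 (4a + 5)\<close>. The two cubics differ by exactly 1,
  so the weight \<open>4a + 1\<close> loses very little.\<close>

lemma central_weighted_mono: "mono (\<lambda>a. (central a)\<^sup>2 * (4 * real a + 1))"
proof (rule incseq_SucI)
  fix a
  have 5: "4 * real (Suc a) + 1 = 4 * real a + 5" by simp
  have "(4 * real a + 1) * (2*real a+2)^2 \<le> (2*real a+1)^2 * (4 * real a + 5)"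
    by (simp add: power2_eq_square algebra_simps)
  hence "4 * real a + 1 \<le> (2*real a+1)^2 / (2*real a+2)^2 * (4 * real a + 5)"
    by (simp add: pos_le_divide_eq)
  hence "(central a)\<^sup>2 * (4 * real a + 1) \<le> (central a)\<^sup>2 * ((2*real a+1)^2 / (2*real a+2)^2 * (4 * real a + 5))"
    by (rule mult_left_mono) simp
  thus "(central a)\<^sup>2 * (4 * real a + 1) \<le> (central (Suc a))\<^sup>2 * (4 * real (Suc a) + 1)"
    unfolding central_Suc power_mult_distrib power_divide 5 by (simp only: times_divide_eq_left times_divide_eq_right mult.assoc)
qed

text \<open>Reduces a comparison of central probabilities at two indices to a polynomial inequality,
  by squaring and using the weighted monotonicity.\<close>

lemma central_le_mult_central:
  assumes "m \<le> a" "0 \<le> X" "4 * real a + 1 \<le> X\<^sup>2 * (4 * real m + 1)"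
  shows "central m \<le> X * central a"
proof -
  have "(central m)\<^sup>2 * (4 * real m + 1) \<le> (central a)\<^sup>2 * (4 * real a + 1)"
    using monoD[OF central_weighted_mono assms(1)] .
  also have "\<dots> \<le> (central a)\<^sup>2 * (X\<^sup>2 * (4 * real m + 1))"
    by (intro mult_left_mono assms) simp
  also have "\<dots> = (X * central a)\<^sup>2 * (4 * real m + 1)"
    by (simp add: power_mult_distrib)
  finally have "(central m)\<^sup>2 \<le> (X * central a)\<^sup>2"
    by (rule mult_right_le_imp_le) simp
  thus ?thesis
    by (rule power2_le_imp_le) (simp add: assms(2) central_pos less_imp_le)
qed

section \<open>Monotonicity of windows between jumps\<close>

lemma sum_shift_window:
  fixes f :: "nat \<Rightarrow> nat"
  assumes "l \<le> u"
  shows "(\<Sum>j=l..u. f (j+1)) + f l = (\<Sum>j=l..u. f j) + f (u+1)"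
  using assms by (induction u rule: dec_induct) auto

text \<open>In probabilities: with the bound \<open>n - 2l\<close> on the absolute sum kept fixed,
  two more signs cannot make the event likelier. Pascal's rule applied twice splits the new window
  into two copies of the old one and its two shifts by one; each shift trades an edge coefficient
  for one at least as far from the centre.\<close>

lemma window_Suc_Suc_le:
  assumes "2 * l \<le> n"
  shows "window (n + 2) (l + 1) \<le> 4 * window n l"
proof -
  define u where "u = n - l"
  \<comment> \<open>The value 0 at \<open>j = 0\<close> is set by hand, since truncated subtraction
    would turn \<open>n choose (j - 1)\<close> into 1 there.\<close>
  define g where "g j = (if j = 0 then 0 else n choose (j - 1))" for j
  have lu: "l \<le> u" "u \<le> n" "n - u = l" using assms by (auto simp: u_def)
  have eq: "(n + 2 choose (j + 1)) = (n choose (j + 1)) + 2 * (n choose j) + g j" for j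
    by (cases j) (simp_all add: g_def)
  have "window (n + 2) (l + 1) = (\<Sum>j=l+1..u+1. n + 2 choose j)"
    using assms by (simp add: window_def u_def Suc_diff_le)
  also have "\<dots> = (\<Sum>j=l..u. n + 2 choose (j + 1))"
    by (rule sum.shift_bounds_cl_nat_ivl)
  also have "\<dots> = (\<Sum>j=l..u. n choose (j + 1)) + 2 * window n l + (\<Sum>j=l..u. g j)"
    by (simp only: eq sum.distrib sum_distrib_left window_def u_def)
  finally have 0: "window (n + 2) (l + 1) = \<dots>" .
  have "(\<Sum>j=l..u. n choose (j + 1)) + (n choose l) = window n l + (n choose (u + 1))"
    using sum_shift_window[OF lu(1), of "\<lambda>j. n choose j"] by (simp only: window_def u_def)
  moreover have "(n choose (u + 1)) \<le> (n choose l)"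
  proof (cases "u + 1 \<le> n")
    case True
    thus ?thesis using binomial_antimono[of u "u + 1" n] binomial_symmetric[of u n] lu assms
      by (simp add: u_def)
  qed (simp add: binomial_eq_0)
  moreover have "(\<Sum>j=l..u. g j) + (n choose u) = window n l + g l"
    using sum_shift_window[OF lu(1), of g] by (simp add: window_def u_def g_def)
  moreover have "g l \<le> (n choose u)"
    using binomial_mono[of "l - 1" l n] binomial_symmetric[of u n] lu assms
    by (simp add: g_def)
  ultimately show ?thesis unfolding 0 by linarith
qed

lemma window_shift_le:
  assumes "2 * l \<le> n"
  shows "window (n + 2 * s) (l + s) \<le> 4 ^ s * window n l"
proof (induction s)
  case (Suc s)
  have "window (n + 2 * Suc s) (l + Suc s) \<le> 4 * window (n + 2 * s) (l + s)"
    using window_Suc_Suc_le[of "l + s" "n + 2 * s"] assms by simp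
  thus ?case using Suc by simp
qed simp

section \<open>Lower bounds for windows\<close>

text \<open>With \<open>N = 2c - d\<close>, the ratio of the coefficients at
  \<open>c + i + 1\<close> and \<open>c + i\<close> is
  \<open>1 - (2i + 1 + d) / (c + i + 1)\<close>, hence at least
  \<open>1 - (2i + 1 + d) / (c + 1)\<close>. A product of factors \<open>1 - y\<close> is bounded
  below by one minus the sum of the \<open>y\<close>, and the numbers \<open>2j + 1 + d\<close> with
  \<open>j < i\<close> add up to \<open>i (i + d)\<close>.\<close>

lemma binomial_off_centre_ge:
  assumes "d \<le> 1" "d + i \<le> c"
  shows "real ((2 * c - d) choose c) * (1 - real (i * (i + d)) / (real c + 1))
           \<le> real ((2 * c - d) choose (c + i))"
  using assms(2)
proof (induction i)
  case (Suc i)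
  define N where "N = 2 * c - d"
  define B where "B = real (N choose c)"
  define x where "x = real (i * (i + d)) / (real c + 1)"
  define y where "y = real (2 * i + 1 + d) / (real c + 1)"
  have xy: "0 \<le> x" "0 \<le> y" "0 \<le> B" by (simp_all add: x_def y_def B_def)
  have step: "(real c + real i + 1) * real (N choose (c + Suc i)) = (real c - real d - real i) * real (N choose (c+i))"
  proof -
    have N: "N = c + i + (c - d - i)" "d + i + 1 \<le> c" using Suc.prems by (auto simp: N_def)
    have "Suc (c+i) * (N choose Suc (c+i)) = (c - d - i) * (N choose (c+i))"
    proof -
      have "Suc (c - d - i - 1) = c - d - i" "Suc (c + i + (c - d - i - 1)) = N"
        using N by auto
      thus ?thesis using Suc_times_binomial_add[of "c + i" "c - d - i - 1"] by (simp only:)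
    qed
    hence "real (Suc (c+i)) * real (N choose Suc (c+i)) = real (c - d - i) * real (N choose (c+i))"
      by (metis of_nat_mult)
    moreover have "real (c - d - i) = real c - real d - real i" using N(2) by linarith
    ultimately show ?thesis by (simp add: add.commute)
  qed
  define q where "q = real c + real i + 1"
  define r where "r = real (2 * i + 1 + d)"
  have "q > 0" by (simp add: q_def)
  have "q * real (N choose (c + Suc i)) = (q - r) * real (N choose (c+i))"
    using step by (simp add: q_def r_def)
  hence "real (N choose (c + Suc i)) = real (N choose (c+i)) * (1 - r / q)"
    using \<open>q > 0\<close> by (simp add: field_simps)
  also have "\<dots> \<ge> real (N choose (c+i)) * (1 - y)"
    unfolding y_def r_def q_def by (intro mult_left_mono diff_left_mono divide_left_mono) simp_all
  finally have 1: "real (N choose (c+i)) * (1 - y) \<le> real (N choose (c + Suc i))" .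
  have e: "x + y = real (Suc i * (Suc i + d)) / (real c + 1)"
    by (simp add: x_def y_def add_divide_distrib[symmetric] algebra_simps)
  have IH: "B * (1 - x) \<le> real (N choose (c + i))"
    using Suc by (simp add: B_def N_def x_def)
  \<comment> \<open>The induction hypothesis may be multiplied by \<open>1 - y\<close> only if this
    is nonnegative; otherwise the claimed bound is itself at most 0.\<close>
  have "B * (1 - (x + y)) \<le> real (N choose (c + Suc i))"
  proof (cases "y \<le> 1")
    case True
    have "B * (1 - (x + y)) \<le> B * ((1 - x) * (1 - y))"
      using xy by (intro mult_left_mono) (auto simp: algebra_simps)
    also have "\<dots> \<le> real (N choose (c+i)) * (1 - y)"
      using mult_right_mono[OF IH, of "1 - y"] True by (simp add: mult.assoc)
    finally show ?thesis using 1 by simp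
  next
    case False
    hence "B * (1 - (x + y)) \<le> 0" using xy by (simp add: mult_nonneg_nonpos)
    thus ?thesis by (meson of_nat_0_le_iff order_trans)
  qed
  thus ?case unfolding e B_def N_def .
qed simp


text \<open>The window has \<open>2h - 1 + d\<close> terms, and each step of the induction adds the
  coefficient at \<open>c + h\<close> and its equal mirror image at \<open>c - d - h\<close>. The
  subtracted fraction is twice the sum of \<open>i (i + d) / (c + 1)\<close> over
  \<open>i < h\<close>.\<close>

lemma window_lower_bound:
  assumes "d \<le> 1" "1 \<le> h" "h + d \<le> c + 1"
  shows "real ((2 * c - d) choose c)
           * (2 * real h - 1 + real d - (real h - 1) * real h * (2 * real h - 1 + 3 * real d) / (3 * (real c + 1)))
         \<le> real (window (2 * c - d) (c + 1 - d - h))"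
  using assms(2,3)
proof (induction h rule: dec_induct)
  case base
  show ?case
  proof (cases "d = 0")
    case True
    thus ?thesis by (simp add: window_def)
  next
    case False
    hence d: "d = 1" "1 \<le> c" using assms base by auto
    have "window (2 * c - d) (c + 1 - d - 1) = (\<Sum>j\<in>{c - 1, c}. 2 * c - d choose j)"
      unfolding window_def using d by (intro sum.cong) auto
    also have "\<dots> = 2 * ((2 * c - d) choose c)"
      using d binomial_symmetric[of c "2 * c - 1"] by simp
    finally show ?thesis using d by simp
  qed
next
  case (step h)
  define N where "N = 2 * c - d"
  define l where "l = c - d - h"
  define B where "B = real (N choose c)"
  have l: "c + 1 - d - h = l + 1" "c + 1 - d - Suc h = l" "N - l = c + h" "N - (l + 1) + 1 = c + h"
      "N - (c + h) = l" "c + h \<le> N" "l < c + h"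
    using step assms by (auto simp: N_def l_def)
  have "window N l = (N choose l) + (\<Sum>j=l+1..c+h. N choose j)"
    using l by (simp add: window_def sum.atLeast_Suc_atMost)
  also have "(\<Sum>j=l+1..c+h. N choose j) = (\<Sum>j=l+1..N-(l+1). N choose j) + (N choose (c + h))"
    using l by (simp flip: l(4))
  also have "(N choose l) = (N choose (c + h))"
    using binomial_symmetric[OF l(6)] l(5) by simp
  finally have W: "real (window N l) = real (window N (l + 1)) + 2 * real (N choose (c + h))"
    by (simp add: window_def)
  have IH: "B * (2 * real h - 1 + real d - (real h - 1) * real h * (2 * real h - 1 + 3 * real d) / (3 * (real c + 1)))
        \<le> real (window N (l + 1))"
    using step.IH step.prems unfolding l(1) B_def N_def by simp
  have K: "B * (1 - real (h * (h + d)) / (real c + 1)) \<le> real (N choose (c + h))"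
    using binomial_off_centre_ge[of d h c] assms step by (simp add: B_def N_def)
  have "B * (2 * real (Suc h) - 1 + real d - (real (Suc h) - 1) * real (Suc h) * (2 * real (Suc h) - 1 + 3 * real d) / (3 * (real c + 1)))
      = B * (2 * real h - 1 + real d - (real h - 1) * real h * (2 * real h - 1 + 3 * real d) / (3 * (real c + 1)))
        + 2 * (B * (1 - real (h * (h + d)) / (real c + 1)))"
    by (simp add: divide_simps) (simp add: algebra_simps)
  also have "\<dots> \<le> real (window N l)" using IH K W by linarith
  finally show ?case unfolding l(2) B_def N_def .
qed

text \<open>When \<open>c\<close> is at least about \<open>2 * h^2\<close>, the subtracted fraction
  is at most one sixth of the main term, which leaves the factor 5/6.\<close>

lemma window_lower_bound_uniform:
  assumes "d \<le> 1" "1 \<le> h" "2 * h\<^sup>2 \<le> c + 1 + 2 * d" "h + d \<le> c + 1"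
  shows "real ((2 * c - d) choose c) * (5 / 6 * (2 * real h - 1 + real d))
         \<le> real (window (2 * c - d) (c + 1 - d - h))"
proof -
  define x where "x = real h"
  have x: "1 \<le> x" using assms by (simp add: x_def)
  have c: "2 * x\<^sup>2 \<le> real c + 1 + 2 * real d"
    using assms(3) unfolding x_def by (metis (mono_tags, opaque_lifting) of_nat_1 of_nat_add of_nat_le_iff of_nat_mult of_nat_numeral of_nat_power)
  have "2 * ((x - 1) * x * (2 * x - 1 + 3 * real d)) \<le> (2 * x - 1 + real d) * (real c + 1)"
  proof (cases "d = 0")
    case True
    have "2 * ((x - 1) * x * (2 * x - 1)) \<le> (2 * x - 1) * (2 * x\<^sup>2)"
      using x by (simp add: power2_eq_square algebra_simps)
    also have "\<dots> \<le> (2 * x - 1) * (real c + 1)"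
      using x c True by (intro mult_left_mono) auto
    finally show ?thesis using True by simp
  next
    case False
    hence d: "d = 1" using assms by simp
    have "2 * ((x - 1) * x * (2 * x + 2)) = (2 * x) * (2 * x\<^sup>2 - 2)"
      by (simp add: power2_eq_square algebra_simps)
    also have "\<dots> \<le> (2 * x) * (real c + 1)"
      using x c d by (intro mult_left_mono) auto
    finally show ?thesis using d by (simp add: add.commute)
  qed
  hence "5 / 6 * (2 * x - 1 + real d) \<le> 2 * x - 1 + real d - (x - 1) * x * (2 * x - 1 + 3 * real d) / (3 * (real c + 1))"
    by (simp add: field_simps)
  hence "real ((2 * c - d) choose c) * (5 / 6 * (2 * real h - 1 + real d))
     \<le> real ((2 * c - d) choose c) * (2 * real h - 1 + real d - (real h - 1) * real h * (2 * real h - 1 + 3 * real d) / (3 * (real c + 1)))"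
    unfolding x_def by (intro mult_left_mono) simp_all
  also have "\<dots> \<le> real (window (2 * c - d) (c + 1 - d - h))"
    by (rule window_lower_bound[OF assms(1,2,4)])
  finally show ?thesis .
qed


section \<open>Comparison at the last index before a jump\<close>

lemma binomial_eq_central:
  assumes "d \<le> 1" "d \<le> c"
  shows "real ((2 * c - d) choose c) = 2 ^ (2 * c - d) * central c"
proof (cases "d = 0")
  case True
  thus ?thesis by (simp add: central_def power_mult)
next
  case False
  then obtain b where b: "d = 1" "c = Suc b" using assms by (cases c) auto
  have "(2 * c choose c) = 2 * ((2 * c - 1) choose c)"
    using binomial_symmetric[of b "2 * b + 1"] b by simp
  hence "real (2 * c choose c) = 2 * real ((2 * c - 1) choose c)" by simp
  moreover have "(4::real) ^ c = 2 * 2 ^ (2 * c - 1)"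
    using b by (simp add: power_mult)
  ultimately show ?thesis using b by (simp add: central_def)
qed

text \<open>The polynomial inequality that \<open>central_le_mult_central\<close> asks for at even
  jumps, with \<open>X = 5/6 (2h - 1)\<close>, \<open>m = M - 1\<close> and
  \<open>c = h^2 M - 1\<close>. Expanded around \<open>h = 2\<close>, \<open>M = 2\<close>, the
  difference of the two sides has only nonnegative coefficients.\<close>

lemma even_scale_ineq:
  fixes h M :: real
  assumes "2 \<le> h" "2 \<le> M"
  shows "4 * h\<^sup>2 * M - 3 \<le> (5 / 6 * (2 * h - 1))\<^sup>2 * (4 * M - 3)"
proof -
  define z y where "z = h - 2" and "y = M - 2"
  have e: "h = 2 + z" "M = 2 + y" by (auto simp: z_def y_def)
  have "0 \<le> z" "0 \<le> y" using assms by (auto simp: z_def y_def)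
  hence "0 \<le> z * y" "0 \<le> z * z" "0 \<le> z * z * y" by auto
  thus ?thesis using \<open>0 \<le> z\<close> \<open>0 \<le> y\<close> unfolding e by (simp add: power2_eq_square field_simps)
qed

text \<open>The counterpart for odd jumps, with \<open>X = 5/6 * 2h\<close> and
  \<open>4c + 1\<close> bounded by \<open>(2h + 1)^2 M + 2\<close>.\<close>

lemma odd_scale_ineq:
  fixes h M :: real
  assumes "2 \<le> h" "2 \<le> M"
  shows "(2 * h + 1)\<^sup>2 * M + 2 \<le> (5 / 6 * (2 * h))\<^sup>2 * (4 * M - 3)"
proof -
  define z y where "z = h - 2" and "y = M - 2"
  have e: "h = 2 + z" "M = 2 + y" by (auto simp: z_def y_def)
  have "0 \<le> z" "0 \<le> y" using assms by (auto simp: z_def y_def)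
  hence "0 \<le> z * y" "0 \<le> z * z" "0 \<le> z * z * y" by auto
  thus ?thesis using \<open>0 \<le> z\<close> \<open>0 \<le> y\<close> unfolding e by (simp add: power2_eq_square field_simps)
qed

text \<open>Here \<open>2h + d\<close> is the first excluded value of the absolute sum,
  \<open>d\<close> its parity, and \<open>c\<close> is the largest integer with
  \<open>2 (2c - d) < (2h + d)^2 M\<close>. So \<open>2c - d\<close> is the last index that the jump
  condition allows.\<close>

lemma window_before_jump:
  assumes "1 \<le> h" "2 \<le> M"
    and c: "d = 0 \<and> c + 1 = h\<^sup>2 * M \<or> d = 1 \<and> 4 * c \<le> (2 * h + 1)\<^sup>2 * M + 1 \<and> (2 * h + 1)\<^sup>2 * M < 4 * c + 3"
  shows "2 ^ (2 * c - d) * central (M - 1) \<le> real (window (2 * c - d) (c + 1 - d - h))"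
proof -
  have d: "d \<le> 1" using c by auto
  have hM: "2 * h\<^sup>2 \<le> h\<^sup>2 * M" "M \<le> h\<^sup>2 * M" "h\<^sup>2 * 2 \<le> h\<^sup>2 * M" "h \<le> h\<^sup>2"
    using assms by (auto simp: power2_eq_square)
  have exp: "(2 * h + 1)\<^sup>2 * M = 4 * (h\<^sup>2 * M) + 4 * (h * M) + M"
    by (simp add: power2_eq_square algebra_simps)
  have hM': "M \<le> h * M" using assms by simp
  have cM: "M - 1 \<le> c" "1 \<le> c" "2 * h\<^sup>2 \<le> c + 1 + 2 * d" "h + d \<le> c + 1"
    using c hM hM' assms unfolding exp by linarith+
  have c4: "d = 0 \<Longrightarrow> 4 * real c + 1 = 4 * (real h)\<^sup>2 * real M - 3"
    "d = 1 \<Longrightarrow> 4 * real c + 1 \<le> (2 * real h + 1)\<^sup>2 * real M + 2"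
  proof -
    assume "d = 0"
    hence "real (c + 1) = real (h\<^sup>2 * M)" using c by simp
    thus "4 * real c + 1 = 4 * (real h)\<^sup>2 * real M - 3" by simp
  next
    assume "d = 1"
    hence "real (4 * c) \<le> real ((2 * h + 1)\<^sup>2 * M + 1)" using c by (subst of_nat_le_iff) auto
    thus "4 * real c + 1 \<le> (2 * real h + 1)\<^sup>2 * real M + 2" by (simp add: add.commute)
  qed
  have M1: "4 * real (M - 1) + 1 = 4 * real M - 3" using assms by (simp add: of_nat_diff)
  \<comment> \<open>For \<open>h = 1\<close> the correction term vanishes and the full number of
    terms \<open>1 + d\<close> is kept. The factor 5/6 cannot be afforded there: for
    \<open>h = 1\<close>, \<open>d = 0\<close> one has \<open>c = M - 1\<close> and the bound is an
    equality.\<close>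
  define X where "X = (if h = 1 then 1 + real d else 5 / 6 * (2 * real h - 1 + real d))"
  have X: "0 \<le> X" using assms by (simp add: X_def)
  have "4 * real c + 1 \<le> X\<^sup>2 * (4 * real (M - 1) + 1)"
  proof (cases "h = 1")
    case True
    thus ?thesis using c4 d assms unfolding M1 by (cases "d = 0") (auto simp: X_def le_Suc_eq)
  next
    case False
    hence "2 \<le> real h" "2 \<le> real M" using assms by auto
    from even_scale_ineq[OF this] odd_scale_ineq[OF this] show ?thesis
      using c4 d False unfolding M1 by (cases "d = 0") (auto simp: X_def le_Suc_eq)
  qed
  hence "central (M - 1) \<le> X * central c"
    by (intro central_le_mult_central cM X)
  hence "2 ^ (2 * c - d) * central (M - 1) \<le> 2 ^ (2 * c - d) * (X * central c)"
    by (intro mult_left_mono) auto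
  also have "\<dots> = real ((2 * c - d) choose c) * X"
    using d cM(2) by (simp add: binomial_eq_central)
  also have "\<dots> \<le> real (window (2 * c - d) (c + 1 - d - h))"
  proof (cases "h = 1")
    case True
    thus ?thesis using window_lower_bound[OF d assms(1) cM(4)] by (simp add: X_def)
  next
    case False
    thus ?thesis using window_lower_bound_uniform[OF d assms(1) cM(3,4)] by (simp add: X_def)
  qed
  finally show ?thesis .
qed

text \<open>The first excluded value \<open>k\<close> stays fixed while \<open>n\<close> grows in
  steps of 2 to the last index with \<open>2n < k^2 M\<close>. The normalised window does not
  increase on the way, so the bound at that index carries over to \<open>n\<close>.\<close>

lemma window_ge_central:
  assumes "2 \<le> M" "2 \<le> k" "k \<le> n + 2" "even (n + k)" "2 * n < k\<^sup>2 * M"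
  shows "2 ^ n * central (M - 1) \<le> real (window n ((n + 2 - k) div 2))"
proof -
  define d h where "d = k mod 2" and "h = k div 2"
  define l where "l = (n + 2 - k) div 2"
  \<comment> \<open>Rounding down gives, for odd \<open>k\<close>, the largest \<open>c\<close> with
    \<open>4c \<le> k^2 M + 1\<close>, which is the same as
    \<open>2 (2c - 1) < k^2 M\<close>.\<close>
  define c where "c = (if d = 0 then h\<^sup>2 * M - 1 else (k\<^sup>2 * M + 1) div 4)"
  have k: "k = 2 * h + d" "d \<le> 1" "1 \<le> h" using assms by (auto simp: d_def h_def)
  have hM: "h\<^sup>2 * 2 \<le> h\<^sup>2 * M" "h \<le> h\<^sup>2"
    using k assms by (auto simp: power2_eq_square)
  hence "0 < h\<^sup>2 * M" using k by linarith
  moreover have "d = 0 \<Longrightarrow> c = h\<^sup>2 * M - 1" by (simp add: c_def)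
  ultimately have c0: "d = 0 \<Longrightarrow> c + 1 = h\<^sup>2 * M" by linarith
  have c1: "4 * c \<le> (2 * h + 1)\<^sup>2 * M + 1 \<and> (2 * h + 1)\<^sup>2 * M < 4 * c + 3" if "d = 1"
  proof -
    have "c = (k\<^sup>2 * M + 1) div 4" "k = 2 * h + 1" using that k by (auto simp: c_def)
    thus ?thesis by simp
  qed
  have "d = 0 \<or> d = 1" using k by auto
  hence cc: "d = 0 \<and> c + 1 = h\<^sup>2 * M \<or> d = 1 \<and> 4 * c \<le> (2 * h + 1)\<^sup>2 * M + 1 \<and> (2 * h + 1)\<^sup>2 * M < 4 * c + 3"
    using c0 c1 by blast
  have l: "n + 2 = k + 2 * l" using assms by (auto simp: l_def)
  have n: "2 * n < (2 * h + d)\<^sup>2 * M" using assms k by simp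
  have le: "l \<le> c + 1 - d - h"
  proof (cases "d = 0")
    case True
    hence "2 * n < 4 * (h\<^sup>2 * M)" using n by (simp add: power2_eq_square)
    thus ?thesis using c0[OF True] True l k by linarith
  next
    case False
    hence "d = 1" using k by simp
    moreover have "2 * n < (2 * h + 1)\<^sup>2 * M" using n \<open>d = 1\<close> by simp
    ultimately show ?thesis using c1 l k by linarith
  qed
  have hd: "h + d \<le> c + 1"
  proof (cases "d = 0")
    case True
    thus ?thesis using c0 hM by linarith
  next
    case False
    hence "d = 1" using k by simp
    moreover have "(2 * h + 1)\<^sup>2 * 2 \<le> (2 * h + 1)\<^sup>2 * M" using assms by simp
    moreover have "(2 * h + 1)\<^sup>2 = 4 * h\<^sup>2 + 4 * h + 1" by (simp add: power2_eq_square)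
    ultimately show ?thesis using c1 hM by linarith
  qed
  define s where "s = c + 1 - d - h - l"
  have s: "n + 2 * s = 2 * c - d" "l + s = c + 1 - d - h" and ln: "2 * l \<le> n"
    using l le hd k assms by (auto simp: s_def)
  have "4 ^ s * (2 ^ n * central (M - 1)) = 2 ^ (2 * c - d) * central (M - 1)"
    by (simp add: s(1)[symmetric] power_add power_mult)
  also have "\<dots> \<le> real (window (2 * c - d) (c + 1 - d - h))"
    by (rule window_before_jump[OF k(3) assms(1) cc])
  also have "\<dots> \<le> real (4 ^ s * window n l)"
    using window_shift_le[OF ln, of s] unfolding s by (simp only: of_nat_le_iff)
  finally show ?thesis by (simp add: l_def)
qed

section \<open>The binomial distribution of the partial sums\<close>

context prob_space
begin

lemma partial_sum_measurable [measurable]: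
  assumes "independent_rademacher M \<epsilon>"
  shows "partial_sum \<epsilon> n \<in> borel_measurable M"
proof -
  have "(\<lambda>\<omega>. \<Sum>i=1..n. \<epsilon> i \<omega>) \<in> borel_measurable M"
    using assms by (intro borel_measurable_sum) (auto simp: independent_rademacher_def rademacher_def)
  thus ?thesis by (simp add: partial_sum_def [abs_def])
qed

lemma prob_partial_sum_step:
  assumes "independent_rademacher M \<epsilon>" "s = 1 \<or> s = - 1"
  shows "\<P>(\<omega> in M. \<epsilon> (Suc n) \<omega> = s \<and> partial_sum \<epsilon> n \<omega> = x) = \<P>(\<omega> in M. partial_sum \<epsilon> n \<omega> = x) / 2"
proof -
  have "indep_vars (\<lambda>_. borel) \<epsilon> (insert (Suc n) {1..n})"
    using assms by (auto simp: independent_rademacher_def intro: indep_vars_subset)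
  from indep_vars_sum[OF _ _ this]
  have "indep_var borel (\<epsilon> (Suc n)) borel (partial_sum \<epsilon> n)"
    by (simp add: partial_sum_def [abs_def])
  from prob_indep_random_variable[OF this, of "{s}" "{x}"]
  have "\<P>(\<omega> in M. \<epsilon> (Suc n) \<omega> = s \<and> partial_sum \<epsilon> n \<omega> = x)
      = \<P>(\<omega> in M. \<epsilon> (Suc n) \<omega> = s) * \<P>(\<omega> in M. partial_sum \<epsilon> n \<omega> = x)"
    by simp
  moreover have "\<P>(\<omega> in M. \<epsilon> (Suc n) \<omega> = s) = 1 / 2"
    using assms by (auto simp: independent_rademacher_def rademacher_def)
  ultimately show ?thesis by simp
qed

text \<open>Splitting by the last sign reproduces Pascal's rule. Stated as an inequality, it needs
  only an inclusion of events, and the null event where a sign is neither 1 nor -1 does not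
  enter.\<close>

lemma prob_partial_sum_eq_ge:
  assumes "independent_rademacher M \<epsilon>"
  shows "real (n choose j) / 2 ^ n \<le> \<P>(\<omega> in M. partial_sum \<epsilon> n \<omega> = 2 * real j - real n)"
proof (induction n arbitrary: j)
  case 0
  show ?case by (cases j) (simp_all add: partial_sum_def prob_space)
next
  case (Suc n)
  note [measurable] = partial_sum_measurable[OF assms]
  have [measurable]: "\<epsilon> (Suc n) \<in> borel_measurable M"
    using assms by (simp add: independent_rademacher_def rademacher_def)
  let ?E = "\<lambda>s x. {\<omega> \<in> space M. \<epsilon> (Suc n) \<omega> = s \<and> partial_sum \<epsilon> n \<omega> = x}"
  define t where "t = 2 * real j - real (Suc n)"
  have "prob (?E 1 (t - 1)) + prob (?E (-1) (t + 1)) = prob (?E 1 (t - 1) \<union> ?E (-1) (t + 1))"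
    by (rule finite_measure_Union[symmetric]) auto
  also have "\<dots> \<le> \<P>(\<omega> in M. partial_sum \<epsilon> (Suc n) \<omega> = t)"
  proof (rule finite_measure_mono)
    show "?E 1 (t - 1) \<union> ?E (- 1) (t + 1) \<subseteq> {\<omega> \<in> space M. partial_sum \<epsilon> (Suc n) \<omega> = t}"
      by (auto simp: partial_sum_def)
  qed measurable
  finally have *: "\<P>(\<omega> in M. partial_sum \<epsilon> n \<omega> = t - 1) / 2 + \<P>(\<omega> in M. partial_sum \<epsilon> n \<omega> = t + 1) / 2
      \<le> \<P>(\<omega> in M. partial_sum \<epsilon> (Suc n) \<omega> = t)"
    by (simp add: prob_partial_sum_step[OF assms])
  have plus: "real (n choose j) / 2 ^ n \<le> \<P>(\<omega> in M. partial_sum \<epsilon> n \<omega> = t + 1)"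
    using Suc.IH[of j] by (simp add: t_def)
  have "real (Suc n choose j) / 2 ^ Suc n \<le> \<P>(\<omega> in M. partial_sum \<epsilon> (Suc n) \<omega> = t)"
  proof (cases j)
    case 0
    have "0 \<le> \<P>(\<omega> in M. partial_sum \<epsilon> n \<omega> = t - 1)" by simp
    moreover define a where "a = real (n choose j) / 2 ^ n"
    moreover have "real (Suc n choose j) / 2 ^ Suc n = a / 2" using 0 by (simp add: a_def)
    ultimately show ?thesis using * plus by linarith
  next
    case (Suc i)
    have "real (n choose i) / 2 ^ n \<le> \<P>(\<omega> in M. partial_sum \<epsilon> n \<omega> = t - 1)"
      using Suc.IH[of i] Suc by (simp add: t_def algebra_simps)
    thus ?thesis using * plus Suc by (simp add: add_divide_distrib)
  qed
  thus ?case by (simp add: t_def)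
qed

lemma prob_partial_sum_ge:
  assumes "independent_rademacher M \<epsilon>" and [measurable]: "A \<in> sets borel"
  shows "(\<Sum>j | j \<le> n \<and> 2 * real j - real n \<in> A. real (n choose j) / 2 ^ n)
           \<le> \<P>(\<omega> in M. partial_sum \<epsilon> n \<omega> \<in> A)"
proof -
  note [measurable] = partial_sum_measurable[OF assms(1)]
  let ?J = "{j. j \<le> n \<and> 2 * real j - real n \<in> A}"
  let ?E = "\<lambda>j. {\<omega> \<in> space M. partial_sum \<epsilon> n \<omega> = 2 * real j - real n}"
  have "(\<Sum>j\<in>?J. real (n choose j) / 2 ^ n) \<le> (\<Sum>j\<in>?J. prob (?E j))"
    by (intro sum_mono prob_partial_sum_eq_ge assms)
  also have "\<dots> = prob (\<Union>j\<in>?J. ?E j)"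
    by (rule finite_measure_finite_Union[symmetric]) (auto simp: disjoint_family_on_def)
  also have "\<dots> \<le> \<P>(\<omega> in M. partial_sum \<epsilon> n \<omega> \<in> A)"
    by (rule finite_measure_mono) auto
  finally show ?thesis .
qed

text \<open>The lower bounds for \<open>A\<close> and for its complement add up to 1, as do the two
  probabilities, so both bounds are equalities.\<close>

lemma prob_partial_sum:
  assumes "independent_rademacher M \<epsilon>" and A [measurable]: "A \<in> sets borel"
  shows "\<P>(\<omega> in M. partial_sum \<epsilon> n \<omega> \<in> A)
           = (\<Sum>j | j \<le> n \<and> 2 * real j - real n \<in> A. real (n choose j) / 2 ^ n)"
proof (rule antisym)
  note [measurable] = partial_sum_measurable[OF assms(1)]
  let ?f = "\<lambda>j. real (n choose j) / 2 ^ n"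
  let ?J = "\<lambda>A. {j. j \<le> n \<and> 2 * real j - real n \<in> A}"
  have "(\<Sum>j\<in>?J A. ?f j) + (\<Sum>j\<in>?J (- A). ?f j) = (\<Sum>j\<le>n. ?f j)"
    by (subst sum.union_disjoint[symmetric]) (auto intro!: sum.cong)
  also have "\<dots> = real (\<Sum>j\<le>n. n choose j) / 2 ^ n"
    by (simp add: sum_divide_distrib)
  also have "\<dots> = 1" unfolding choose_row_sum by simp
  finally have 1: "(\<Sum>j\<in>?J A. ?f j) + (\<Sum>j\<in>?J (- A). ?f j) = 1" .
  have "\<P>(\<omega> in M. partial_sum \<epsilon> n \<omega> \<in> - A) = 1 - \<P>(\<omega> in M. partial_sum \<epsilon> n \<omega> \<in> A)"
    using prob_neg[of "\<lambda>\<omega>. partial_sum \<epsilon> n \<omega> \<in> A"] by simp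
  with 1 prob_partial_sum_ge[OF assms(1), of "- A" n]
  show "\<P>(\<omega> in M. partial_sum \<epsilon> n \<omega> \<in> A) \<le> (\<Sum>j\<in>?J A. ?f j)" by simp
qed (rule prob_partial_sum_ge[OF assms])

section \<open>Bounds and exact values for \<open>P\<close>\<close>

lemma P_eq_sum:
  assumes "independent_rademacher M \<epsilon>"
  shows "P M \<epsilon> \<xi> n = (\<Sum>j | j \<le> n \<and> \<bar>2 * real j - real n\<bar> \<le> \<xi> * sqrt (real n). real (n choose j) / 2 ^ n)"
proof -
  have "{x. \<bar>x\<bar> \<le> \<xi> * sqrt (real n)} \<in> sets borel" by measurable
  from prob_partial_sum[OF assms this, of n] show ?thesis by (simp add: P_def)
qed

text \<open>If \<open>k\<close> is the first excluded value, then
  \<open>2n \<le> \<xi>^2 (m + 1) n < k^2 (m + 1)\<close>, which is the hypothesis of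
  \<open>window_ge_central\<close> with \<open>M = m + 1\<close>. The condition on odd
  \<open>n\<close> keeps the values 1 and -1 inside the event, so that \<open>k\<close> is not
  1.\<close>

lemma P_ge_central:
  assumes "independent_rademacher M \<epsilon>" "0 < \<xi>" "\<xi> \<le> 1" "1 \<le> m" "2 \<le> \<xi>\<^sup>2 * (real m + 1)"
    and odd: "odd n \<Longrightarrow> 1 \<le> \<xi>\<^sup>2 * real n"
  shows "central m \<le> P M \<epsilon> \<xi> n"
proof -
  define t where "t = \<xi> * sqrt (real n)"
  have t: "0 \<le> t" "t\<^sup>2 = \<xi>\<^sup>2 * real n"
    using assms by (simp_all add: t_def power_mult_distrib)
  \<comment> \<open>The first value of \<open>\<bar>S\<^sub>n\<bar>\<close> that lies outside the event.\<close>
  define k where "k = (LEAST k. even (n + k) \<and> t < real k)"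
  have "t\<^sup>2 \<le> real n"
    unfolding t(2) using assms by (intro mult_left_le_one_le) (auto simp: power_le_one)
  also have "\<dots> < (real (n + 2))\<^sup>2" by (simp add: power2_eq_square algebra_simps add_pos_nonneg)
  finally have "t < real (n + 2)" by (rule power2_less_imp_less) simp
  hence ex: "even (n + (n + 2)) \<and> t < real (n + 2)" by simp
  have k: "even (n + k)" "t < real k"
    using LeastI[of "\<lambda>k. even (n + k) \<and> t < real k", OF ex] by (auto simp: k_def)
  have kn: "k \<le> n + 2" unfolding k_def by (rule Least_le) (rule ex)
  have k2: "2 \<le> k"
  proof (rule ccontr)
    assume "\<not> 2 \<le> k"
    moreover have "k \<noteq> 0" using t(1) k(2) by auto
    ultimately have k1: "k = 1" by simp
    hence "1 \<le> t\<^sup>2" using k odd t by simp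
    hence "1 \<le> t" using t(1) by (intro power2_le_imp_le[of 1 t]) simp_all
    thus False using k k1 by simp
  qed
  \<comment> \<open>\<open>k - 2\<close> has the parity of \<open>k\<close>, so minimality of
    \<open>k\<close> places it inside the event.\<close>
  have tk: "real k - 2 \<le> t"
  proof (rule ccontr)
    assume "\<not> real k - 2 \<le> t"
    hence "even (n + (k - 2)) \<and> t < real (k - 2)" using k k2 by (simp add: of_nat_diff)
    hence "k \<le> k - 2" unfolding k_def by (rule Least_le)
    thus False using k2 by simp
  qed
  have "2 * real n \<le> \<xi>\<^sup>2 * (real m + 1) * real n" using assms by (intro mult_right_mono) auto
  also have "\<dots> = t\<^sup>2 * (real m + 1)" by (simp add: t)
  also have "\<dots> < (real k)\<^sup>2 * (real m + 1)"
    using t k by (intro mult_strict_right_mono power_strict_mono) auto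
  finally have "real (2 * n) < real (k\<^sup>2 * (m + 1))" by (simp add: distrib_left)
  hence nk: "2 * n < k\<^sup>2 * (m + 1)" by (simp only: of_nat_less_iff)
  define l where "l = (n + 2 - k) div 2"
  have l: "n + 2 = k + 2 * l" using k kn by (auto simp: l_def)
  have "central m \<le> real (window n l) / 2 ^ n"
    using window_ge_central[OF _ k2 kn k(1) nk] assms(4) by (simp add: l_def field_simps)
  also have "\<dots> = (\<Sum>j\<in>{l..n-l}. real (n choose j) / 2 ^ n)"
    by (simp add: window_def sum_divide_distrib)
  also have "\<dots> \<le> P M \<epsilon> \<xi> n"
    unfolding P_eq_sum[OF assms(1)]
  proof (rule sum_mono2)
    show "{l..n-l} \<subseteq> {j. j \<le> n \<and> \<bar>2 * real j - real n\<bar> \<le> \<xi> * sqrt (real n)}"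
    proof
      fix j assume j: "j \<in> {l..n-l}"
      have "real n + 2 = real k + 2 * real l" using arg_cong[OF l, of real] by simp
      moreover have "real l \<le> real j" "real j + real l \<le> real n"
        using j l k2 by (auto simp flip: of_nat_add)
      ultimately have "\<bar>2 * real j - real n\<bar> \<le> t" using tk by linarith
      thus "j \<in> {j. j \<le> n \<and> \<bar>2 * real j - real n\<bar> \<le> \<xi> * sqrt (real n)}"
        using j by (auto simp: t_def)
    qed
  qed auto
  finally show ?thesis .
qed

text \<open>The radius is below 2 and the sum is even, so only the value 0 is counted.\<close>

lemma P_double:
  assumes "independent_rademacher M \<epsilon>" "0 < \<xi>" "\<xi>\<^sup>2 * real m < 2"
  shows "P M \<epsilon> \<xi> (2 * m) = central m"
proof -
  have "(\<xi> * sqrt (real (2 * m)))\<^sup>2 < 2\<^sup>2" using assms by (simp add: power_mult_distrib mult.commute)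
  hence "\<xi> * sqrt (real (2 * m)) < 2" by (rule power2_less_imp_less) simp
  moreover have "\<bar>2 * real j - real (2 * m)\<bar> \<ge> 2" if "j \<noteq> m" for j
    using that by (cases "j < m") auto
  ultimately have "{j. j \<le> 2 * m \<and> \<bar>2 * real j - real (2 * m)\<bar> \<le> \<xi> * sqrt (real (2 * m))} = {m}"
    using assms by (auto intro!: equalityI)
  thus ?thesis unfolding P_eq_sum[OF assms(1)] by (simp add: central_def power_mult)
qed

end

section \<open>The thresholds and the final statement\<close>

lemma sqrt_le_imp:
  assumes "sqrt a \<le> x" "0 \<le> a"
  shows "a \<le> x\<^sup>2"
  using power_mono[OF assms(1), of 2] assms(2) by simp

theorem corollary2:
  fixes M :: "'a measure" and \<epsilon> :: "nat \<Rightarrow> 'a \<Rightarrow> real" and \<xi> :: real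
  assumes "prob_space M"
    and "independent_rademacher M \<epsilon>"
    and "0 < \<xi>" and "\<xi> \<le> 1"
  shows "(\<forall>n::nat. n \<ge> 2 \<longrightarrow>
            (\<xi> = 1 \<longrightarrow> P M \<epsilon> \<xi> n \<ge> 1 / 2) \<and>
            (sqrt (2 / 3) \<le> \<xi> \<and> \<xi> < 1 \<longrightarrow> P M \<epsilon> \<xi> n \<ge> 3 / 8) \<and>
            (sqrt (1 / 2) \<le> \<xi> \<and> \<xi> < sqrt (2 / 3) \<longrightarrow> P M \<epsilon> \<xi> n \<ge> 5 / 16)) \<and>
         (n_idx \<xi> 2 \<ge> 3 \<and> odd (n_idx \<xi> 2) \<longrightarrow>
            2 / sqrt (real_of_int (n_idx \<xi> 2 + 1)) \<le> \<xi> \<and>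
            \<xi> < 2 / sqrt (real_of_int (n_idx \<xi> 2 - 1)) \<and>
            n_idx \<xi> 1 = 2 * \<lceil>real_of_int (n_idx \<xi> 2 - 3) / 8\<rceil> \<and>
            (\<forall>n::nat. int n \<ge> n_idx \<xi> 1 \<longrightarrow> P M \<epsilon> \<xi> n \<ge> P M \<epsilon> \<xi> (nat (n_idx \<xi> 2 - 1))) \<and>
            P M \<epsilon> \<xi> (nat (n_idx \<xi> 2 - 1)) =
              real (nat (n_idx \<xi> 2 - 1) choose nat ((n_idx \<xi> 2 - 1) div 2))
                / 2 ^ nat (n_idx \<xi> 2 - 1))"
proof -
  interpret prob_space M by fact
  note rad = assms(2)
  have xi2: "0 < \<xi>\<^sup>2" using assms by simp
  \<comment> \<open>The thresholds 1, 2/3 and 1/2 for \<open>\<xi>^2\<close> are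
    \<open>2 / (m + 1)\<close> at \<open>m = 1, 2, 3\<close>. An odd \<open>n\<close> from 2 on is
    at least 3, which gives \<open>\<xi>^2 n \<ge> 1\<close> for these \<open>m\<close>.\<close>
  have small: "central m \<le> P M \<epsilon> \<xi> n"
    if "1 \<le> m" "m \<le> 3" "2 / (real m + 1) \<le> \<xi>\<^sup>2" "2 \<le> n" for m n
  proof (rule P_ge_central[OF rad assms(3,4) that(1)])
    show "2 \<le> \<xi>\<^sup>2 * (real m + 1)" using that by (simp add: field_simps)
    assume "odd n"
    hence "3 \<le> n" using that by (cases "n = 2") auto
    have "1 \<le> 2 / (real m + 1) * real n" using that \<open>3 \<le> n\<close> by (simp add: field_simps)
    also have "\<dots> \<le> \<xi>\<^sup>2 * real n" using that by (intro mult_right_mono) auto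
    finally show "1 \<le> \<xi>\<^sup>2 * real n" .
  qed
  have "central 1 = 1 / 2" "central 2 = 3 / 8" "central 3 = 5 / 16"
    by (simp_all add: central_def numeral_eq_Suc)
  hence first: "(\<xi> = 1 \<longrightarrow> P M \<epsilon> \<xi> n \<ge> 1 / 2) \<and>
            (sqrt (2 / 3) \<le> \<xi> \<and> \<xi> < 1 \<longrightarrow> P M \<epsilon> \<xi> n \<ge> 3 / 8) \<and>
            (sqrt (1 / 2) \<le> \<xi> \<and> \<xi> < sqrt (2 / 3) \<longrightarrow> P M \<epsilon> \<xi> n \<ge> 5 / 16)" if "2 \<le> n" for n
    using small[of 1 n] small[of 2 n] small[of 3 n] that sqrt_le_imp[of "2/3" \<xi>] sqrt_le_imp[of "1/2" \<xi>]
    by auto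
  define z where "z = 1 / \<xi>\<^sup>2"
  have z1: "1 \<le> z" using assms by (simp add: z_def power_le_one)
  have xz: "\<xi>\<^sup>2 = 1 / z" by (simp add: z_def)
  \<comment> \<open>The integer with \<open>m < 2 / \<xi>^2 \<le> m + 1\<close>: the right
    inequality serves the lower bound on \<open>P\<close>, the strict left one the exact value at
    \<open>2 * m\<close>.\<close>
  define m where "m = nat (\<lceil>2 * z\<rceil> - 1)"
  have "2 \<le> \<lceil>2 * z\<rceil>" using z1 by linarith
  hence m: "\<lceil>2 * z\<rceil> = int m + 1" "1 \<le> m" by (simp_all add: m_def nat_le_eq_zle le_nat_iff)
  have mz: "real m < 2 * z" "2 * z \<le> real m + 1"
    using ceiling_correct[of "2 * z"] unfolding m(1) by auto
  have n2: "n_idx \<xi> 2 = 2 * int m + 1"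
  proof -
    have "((real 2)\<^sup>2 / \<xi>\<^sup>2 + real 2) / 2 = 2 * z + 1" by (simp add: z_def add_divide_distrib)
    moreover have "\<lceil>2 * z + 1\<rceil> = int m + 2" using m(1) by simp
    ultimately show ?thesis by (simp only: n_idx_def) simp
  qed
  define c where "c = \<lceil>real_of_int (n_idx \<xi> 2 - 3) / 8\<rceil>"
  have c: "real_of_int c - 1 < (real m - 1) / 4" "(real m - 1) / 4 \<le> real_of_int c"
  proof -
    have "real_of_int (n_idx \<xi> 2 - 3) / 8 = (real m - 1) / 4" by (simp add: n2)
    thus "real_of_int c - 1 < (real m - 1) / 4" "(real m - 1) / 4 \<le> real_of_int c"
      unfolding c_def by linarith+
  qed
  \<comment> \<open>Integrality sharpens \<open>4 (c - 1) < m - 1\<close> to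
    \<open>4 (c - 1) \<le> m - 2\<close>. This yields \<open>2c - 1 \<le> m / 2 < z\<close>, the
    strict half of the characterisation of the ceiling in \<open>n1\<close>.\<close>
  have "real_of_int (4 * (c - 1)) < real_of_int (int m - 1)" using c(1) by simp
  hence "4 * (c - 1) < int m - 1" by (simp only: of_int_less_iff)
  hence "4 * (c - 1) \<le> int m - 2" by simp
  hence "real_of_int (4 * (c - 1)) \<le> real_of_int (int m - 2)" by (simp only: of_int_le_iff)
  hence c': "4 * (real_of_int c - 1) \<le> real m - 2" by simp
  have n1: "n_idx \<xi> 1 = 2 * c"
  proof -
    have "\<lceil>((real 1)\<^sup>2 / \<xi>\<^sup>2 + real 1) / 2\<rceil> = c + 1"
      using c c' mz by (intro ceiling_unique) (auto simp: z_def[symmetric])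
    thus ?thesis by (simp add: n_idx_def)
  qed
  have eq: "P M \<epsilon> \<xi> (2 * m) = central m"
    using mz z1 by (intro P_double[OF rad assms(3)]) (simp add: xz field_simps)
  have ge: "central m \<le> P M \<epsilon> \<xi> n" if "2 * c \<le> int n" for n
  proof (rule P_ge_central[OF rad assms(3,4) m(2)])
    show "2 \<le> \<xi>\<^sup>2 * (real m + 1)" using mz z1 by (simp add: xz field_simps)
    assume "odd n"
    \<comment> \<open>Since \<open>2 * c\<close> is even, an odd \<open>n\<close> is at least
      \<open>2c + 1\<close>, and \<open>2c + 1 \<ge> (m + 1) / 2 \<ge> z\<close>.\<close>
    hence "2 * c + 1 \<le> int n" using that by presburger
    hence "real_of_int (2 * c + 1) \<le> real_of_int (int n)" by (simp only: of_int_le_iff)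
    hence "z \<le> real n" using c mz by simp
    thus "1 \<le> \<xi>\<^sup>2 * real n" using z1 by (simp add: xz field_simps)
  qed
  have lower: "2 / sqrt (2 * real m + 2) \<le> \<xi>"
  proof (rule power2_le_imp_le)
    show "(2 / sqrt (2 * real m + 2))\<^sup>2 \<le> \<xi>\<^sup>2"
      using mz z1 by (simp add: power_divide xz field_simps)
  qed (use assms in simp)
  have upper: "\<xi> < 2 / sqrt (2 * real m)"
  proof (rule power2_less_imp_less)
    show "\<xi>\<^sup>2 < (2 / sqrt (2 * real m))\<^sup>2"
      using mz z1 m(2) by (simp add: power_divide xz field_simps)
  qed simp
  have idx: "nat (n_idx \<xi> 2 - 1) = 2 * m" "nat ((n_idx \<xi> 2 - 1) div 2) = m"
    "real_of_int (n_idx \<xi> 2 + 1) = 2 * real m + 2" "real_of_int (n_idx \<xi> 2 - 1) = 2 * real m"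
    by (simp_all add: n2)
  have "central m = real (2 * m choose m) / 2 ^ (2 * m)"
    by (simp add: central_def power_mult)
  thus ?thesis
    using first lower upper n1 eq ge unfolding idx c_def[symmetric] by auto
qed

end
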